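(* Let $G=(V,E)$ be a connected claw-free graph on $n$ vertices. Then $\alpha(G)=a(G)$ if and only if one of the following holds: (1) $a(G)\geq \frac n2$ and $\alpha'(G)=a(G)$; (2) $a(G)=\frac{n-1}{2}$ and $\alpha'(G-v)=a(G)$ for some vertex $v\in V$.
   Context: All graphs are finite and simple. A graph is claw-free if it contains no induced subgraph isomorphic to $K_{1,3}$. $\alpha(G)$ denotes the independence number of $G$. For a set $S\subseteq V$, $\mathcal{N}(S)$ denotes the set of vertices adjacent to at least one vertex of $S$. An independent set $I$ is critical if $|I|-|\mathcal{N}(I)|$ is maximum among all independent sets of $G$; the critical independence number $\alpha'(G)$ is the maximum cardinality of a critical independent set. The annihilation number $a(G)$: if $d_1\leq \dots\leq d_n$ are the vertex degrees of $G$ in nondecreasing order, $a(G)$ is the largest $k$ such that $\sum_{i=1}^k d_i\leq |E|$. $G-v$ denotes the graph obtained by deleting $v$ and its incident edges. *)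

theory Defs
  imports "Graph_Theory.Graph_Theory"
begin

text \<open>
  Finite simple graphs are the symmetric, loop-free digraphs without multiple arcs of the locale
  \<^locale>\<open>graph\<close>.  Each undirected edge is thus represented by two opposite arcs; the degree of a
  vertex is its \<^const>\<open>out_degree\<close>, whereas edges have to be counted as unordered pairs.
\<close>

definition edges :: "('a, 'b) pre_digraph \<Rightarrow> 'a set set" where
  "edges G = {{u, v} | u v. u \<rightarrow>\<^bsub>G\<^esub> v}"

definition claw_free :: "('a, 'b) pre_digraph \<Rightarrow> bool" where
  "claw_free G \<longleftrightarrow> \<not> (\<exists>H. induced_subgraph H G \<and> complete_bipartite_digraph 1 3 H)"

definition neighbours :: "('a, 'b) pre_digraph \<Rightarrow> 'a set \<Rightarrow> 'a set" where
  "neighbours G S = {v \<in> verts G. \<exists>u \<in> S. u \<rightarrow>\<^bsub>G\<^esub> v}"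

definition independent_set :: "('a, 'b) pre_digraph \<Rightarrow> 'a set \<Rightarrow> bool" where
  "independent_set G I \<longleftrightarrow> I \<subseteq> verts G \<and> (\<forall>u \<in> I. \<forall>v \<in> I. \<not> u \<rightarrow>\<^bsub>G\<^esub> v)"

definition independence_number :: "('a, 'b) pre_digraph \<Rightarrow> nat" where
  "independence_number G = Max {card I | I. independent_set G I}"

definition critical_independent_set :: "('a, 'b) pre_digraph \<Rightarrow> 'a set \<Rightarrow> bool" where
  "critical_independent_set G I \<longleftrightarrow> independent_set G I \<and>
     (\<forall>J. independent_set G J \<longrightarrow>
        int (card J) - int (card (neighbours G J)) \<le> int (card I) - int (card (neighbours G I)))"

definition critical_independence_number :: "('a, 'b) pre_digraph \<Rightarrow> nat" where
  "critical_independence_number G = Max {card I | I. critical_independent_set G I}"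

definition degree_sequence :: "('a, 'b) pre_digraph \<Rightarrow> nat list" where
  "degree_sequence G = sorted_list_of_multiset (image_mset (out_degree G) (mset_set (verts G)))"

definition annihilation_number :: "('a, 'b) pre_digraph \<Rightarrow> nat" where
  "annihilation_number G =
     Max {k. k \<le> card (verts G) \<and> sum_list (take k (degree_sequence G)) \<le> card (edges G)}"

end

theory Submission
  imports Defs
begin

text \<open>
  In every graph \<open>\<alpha> \<le> a\<close> and \<open>\<lfloor>n/2\<rfloor> \<le> a\<close>, so only the existence of critical sets of size \<open>\<alpha>\<close>
  needs an argument.  Let \<open>J\<close> be independent with \<open>|N(J)| < |J|\<close> and let \<open>S \<subseteq> J\<close> be minimal with
  \<open>|N(S)| < |S|\<close>.  By minimality \<open>|S| = |N(S)| + 1\<close> and every vertex of \<open>N(S)\<close> has two neighbours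
  in \<open>S\<close>, so a neighbour of it outside \<open>S \<union> N(S)\<close> would create a claw.  By connectedness
  \<open>S \<union> N(S) = V\<close>, hence \<open>J = S\<close> and \<open>n = 2|J| - 1\<close>.  Consequently a maximum independent set \<open>I\<close> of
  size at least \<open>n/2\<close> is critical.  If \<open>|I| = (n-1)/2\<close>, then the subsets of \<open>I\<close> satisfy Hall's
  condition, which survives the removal of a suitable vertex \<open>v\<close> outside \<open>I\<close>; in \<open>G - v\<close> the set \<open>I\<close>
  has \<open>|N(I)| = |I|\<close> and no independent set has fewer neighbours than elements.
\<close>

section \<open>Initial sums of sorted lists\<close>

text \<open>Greedy exchange by induction on \<open>xs\<close>: \<open>N\<close> gives up one element
  not smaller than the head, after which it fits into the tail.\<close>

lemma sum_list_take_sorted_le: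
  fixes xs :: "nat list"
  assumes "sorted xs" and "N \<subseteq># mset xs"
  shows "sum_list (take (size N) xs) \<le> sum_mset N"
  using assms
proof (induction xs arbitrary: N)
  case Nil
  then show ?case by simp
next
  case (Cons x xs)
  show ?case
  proof (cases "N = {#}")
    case True
    then show ?thesis by simp
  next
    case False
    \<comment> \<open>If \<open>x\<close> occurs in \<open>N\<close>, take \<open>y = x\<close>.
      Otherwise \<open>N\<close> already lies in the tail, so any \<open>y\<close> in
      \<open>N\<close> will do, and sortedness gives \<open>x \<le> y\<close>.\<close>
    obtain y where y: "y \<in># N" "x \<le> y" "N - {#y#} \<subseteq># mset xs"
    proof (cases "x \<in># N")
      case True
      then show ?thesis
        using that[of x] Cons.prems by (simp add: subset_eq_diff_conv)
    next
      case x: False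
      obtain y where "y \<in># N" using False by blast
      moreover have "N \<subseteq># mset xs"
      proof (rule mset_subset_eqI)
        fix a
        show "count N a \<le> count (mset xs) a"
          using mset_subset_eq_count[OF Cons.prems(2), of a] x
          by (cases "a = x") (auto simp: not_in_iff)
      qed
      moreover from calculation have "x \<le> y"
        using Cons.prems(1) by (auto dest: mset_subset_eqD)
      ultimately show ?thesis
        using that[of y] by (meson diff_subset_eq_self subset_mset.order_trans)
    qed
    then obtain M where N: "N = add_mset y M" by (metis insert_DiffM)
    then have "sum_list (take (size M) xs) \<le> sum_mset M"
      using Cons.IH[of M] Cons.prems(1) y(3) by simp
    with N y(2) show ?thesis by simp
  qed
qed

text \<open>The second block of \<open>k\<close> entries is a submultiset of size \<open>k\<close>,
  so the preceding bound compares the first block with it.\<close>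

lemma sum_list_take_sorted_half:
  fixes xs :: "nat list"
  assumes "sorted xs" and "2 * k \<le> length xs"
  shows "2 * sum_list (take k xs) \<le> sum_list xs"
proof -
  have split: "xs = take k xs @ take k (drop k xs) @ drop k (drop k xs)"
    by (simp only: append_take_drop_id)
  have "mset (take k (drop k xs)) \<subseteq># mset xs"
    by (subst (2) split) simp
  from sum_list_take_sorted_le[OF assms(1) this]
  have "sum_list (take k xs) \<le> sum_list (take k (drop k xs))"
    using assms(2) by (simp add: sum_mset_sum_list)
  moreover have "sum_list xs = sum_list (take k xs) + sum_list (take k (drop k xs))
      + sum_list (drop k (drop k xs))"
    by (subst split) (simp only: sum_list_append add.assoc)
  ultimately show ?thesis by linarith
qed

section \<open>Independent sets and neighbourhoods; deletion of a vertex\<close>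

lemma dominates_del_vert:
  "u \<rightarrow>\<^bsub>pre_digraph.del_vert G v\<^esub> w \<longleftrightarrow> u \<rightarrow>\<^bsub>G\<^esub> w \<and> u \<noteq> v \<and> w \<noteq> v"
  by (auto simp: arcs_ends_conv pre_digraph.del_vert_simps)

lemma independent_set_del_vert:
  "independent_set (pre_digraph.del_vert G v) I \<longleftrightarrow> independent_set G I \<and> v \<notin> I"
  by (auto simp: independent_set_def dominates_del_vert pre_digraph.del_vert_simps)

lemma neighbours_del_vert:
  assumes "v \<notin> S"
  shows "neighbours (pre_digraph.del_vert G v) S = neighbours G S - {v}"
  using assms by (auto simp: neighbours_def dominates_del_vert pre_digraph.del_vert_simps)

lemma independent_set_subset:
  "independent_set G I \<Longrightarrow> J \<subseteq> I \<Longrightarrow> independent_set G J"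
  by (auto simp: independent_set_def)

lemma neighbours_mono: "S \<subseteq> T \<Longrightarrow> neighbours G S \<subseteq> neighbours G T"
  by (auto simp: neighbours_def)

lemma neighbours_Un: "neighbours G (S \<union> T) = neighbours G S \<union> neighbours G T"
  by (auto simp: neighbours_def)

lemma independent_set_neighbours_disjoint:
  "independent_set G I \<Longrightarrow> I \<inter> neighbours G I = {}"
  by (auto simp: independent_set_def neighbours_def)

section \<open>Extremal independent and critical sets\<close>

context fin_digraph
begin

lemma finite_neighbours [simp]: "finite (neighbours G S)"
  by (simp add: neighbours_def)

lemma finite_independent_set: "independent_set G I \<Longrightarrow> finite I"
  by (auto simp: independent_set_def intro: finite_subset)

lemma finite_independent_sets: "finite {I. independent_set G I}"
  by (rule finite_subset[of _ "Pow (verts G)"]) (auto simp: independent_set_def)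

lemma card_independent_set_le:
  "independent_set G I \<Longrightarrow> card I \<le> independence_number G"
  unfolding independence_number_def
  using finite_independent_sets by (intro Max_ge) (auto simp: setcompr_eq_image)

lemma obtain_maximum_independent_set:
  obtains I where "independent_set G I" "card I = independence_number G"
proof -
  have "independent_set G {}" by (simp add: independent_set_def)
  then have "independence_number G \<in> {card I | I. independent_set G I}"
    unfolding independence_number_def using finite_independent_sets
    by (intro Max_in) (auto simp: setcompr_eq_image)
  then show ?thesis using that by auto
qed

lemma card_critical_independent_set_le:
  assumes "critical_independent_set G I"
  shows "card I \<le> critical_independence_number G"
proof -
  have "finite {I. critical_independent_set G I}"
    by (rule finite_subset[OF _ finite_independent_sets]) (auto simp: critical_independent_set_def)
  then show ?thesis
    unfolding critical_independence_number_def
    using assms by (intro Max_ge) (auto simp: setcompr_eq_image)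
qed

text \<open>There are finitely many independent sets, among them the empty one, so the difference
  attains its maximum. Hence the \<open>Max\<close> defining the critical independence number ranges
  over a nonempty set.\<close>

lemma obtain_maximum_critical_independent_set:
  obtains I where "critical_independent_set G I" "card I = critical_independence_number G"
proof -
  define d where "d J = int (card J) - int (card (neighbours G J))" for J
  let ?D = "d ` {I. independent_set G I}"
  have "independent_set G {}" by (simp add: independent_set_def)
  then have "Max ?D \<in> ?D"
    using finite_independent_sets by (intro Max_in) auto
  then obtain I where I: "independent_set G I" "d I = Max ?D" by auto
  have "critical_independent_set G I"
    unfolding critical_independent_set_def d_def[symmetric]
    using I finite_independent_sets by (auto intro: Max_ge)
  moreover have "finite {I. critical_independent_set G I}"
    by (rule finite_subset[OF _ finite_independent_sets]) (auto simp: critical_independent_set_def)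
  ultimately have "critical_independence_number G \<in> {card I | I. critical_independent_set G I}"
    unfolding critical_independence_number_def
    by (intro Max_in) (auto simp: setcompr_eq_image)
  then show ?thesis using that by auto
qed

lemma critical_independence_number_le:
  "critical_independence_number G \<le> independence_number G"
proof -
  obtain I where "critical_independent_set G I" "card I = critical_independence_number G"
    by (rule obtain_maximum_critical_independent_set)
  then show ?thesis
    using card_independent_set_le[of I] by (simp add: critical_independent_set_def)
qed

lemma independence_number_del_vert_le:
  "independence_number (del_vert v) \<le> independence_number G"
proof -
  interpret H: fin_digraph "del_vert v" by (rule fin_digraph_del_vert)
  obtain I where "independent_set (del_vert v) I" "card I = independence_number (del_vert v)"
    by (rule H.obtain_maximum_independent_set)
  then show ?thesis
    using card_independent_set_le[of I] by (simp add: independent_set_del_vert)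
qed

section \<open>Degree sums, edges and the annihilation number\<close>

lemma sum_out_degree: "S \<subseteq> verts G \<Longrightarrow>
    (\<Sum>v\<in>S. out_degree G v) = card {e \<in> arcs G. tail G e \<in> S}"
proof -
  assume "S \<subseteq> verts G"
  then have "finite S" by (rule finite_subset) simp
  then have "card (\<Union>v\<in>S. out_arcs G v) = (\<Sum>v\<in>S. card (out_arcs G v))"
    by (intro card_UN_disjoint) (auto simp: out_arcs_def)
  moreover have "(\<Union>v\<in>S. out_arcs G v) = {e \<in> arcs G. tail G e \<in> S}"
    by (auto simp: out_arcs_def)
  ultimately show ?thesis by (simp add: out_degree_def)
qed

lemma edges_conv: "edges G = (\<lambda>e. {tail G e, head G e}) ` arcs G"
  by (auto simp: edges_def arcs_ends_conv)

lemma finite_edges: "finite (edges G)"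
  by (simp add: edges_conv)

lemma mset_degree_sequence:
  "mset (degree_sequence G) = image_mset (out_degree G) (mset_set (verts G))"
  by (simp add: degree_sequence_def)

lemma sorted_degree_sequence: "sorted (degree_sequence G)"
  by (simp add: degree_sequence_def)

lemma length_degree_sequence: "length (degree_sequence G) = card (verts G)"
  by (metis mset_degree_sequence size_mset size_image_mset size_mset_set)

lemma sum_list_degree_sequence:
  "sum_list (degree_sequence G) = (\<Sum>v\<in>verts G. out_degree G v)"
  by (simp add: sum_mset_sum_list[symmetric] mset_degree_sequence sum_unfold_sum_mset)

lemma annihilation_number_ge:
  assumes "k \<le> card (verts G)" "sum_list (take k (degree_sequence G)) \<le> card (edges G)"
  shows "k \<le> annihilation_number G"
  unfolding annihilation_number_def using assms by (intro Max_ge) auto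

end

context digraph
begin

text \<open>Arcs are determined by their ends, so at most the two arcs (u, v) and (v, u) give the
  edge {u, v}.\<close>

lemma card_arcs_le: "card (arcs G) \<le> 2 * card (edges G)"
proof -
  define F where "F x = {e \<in> arcs G. {tail G e, head G e} = x}" for x
  have "arcs G = (\<Union>x\<in>edges G. F x)"
    by (auto simp: edges_conv F_def)
  then have "card (arcs G) = card (\<Union>x\<in>edges G. F x)"
    by (rule arg_cong)
  also have "\<dots> \<le> (\<Sum>x\<in>edges G. card (F x))"
    by (rule card_UN_le[OF finite_edges])
  also have "\<dots> \<le> (\<Sum>x\<in>edges G. 2)"
  proof (rule sum_mono)
    fix x assume "x \<in> edges G"
    then obtain u v where x: "x = {u, v}" unfolding edges_def by blast
    have "card (F x) \<le> card {(u, v), (v, u)}"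
    proof (rule card_inj_on_le)
      show "inj_on (arc_to_ends G) (F x)"
        by (rule inj_on_subset[OF inj_on_arc_to_ends]) (auto simp: F_def)
      show "arc_to_ends G ` F x \<subseteq> {(u, v), (v, u)}"
        unfolding F_def x doubleton_eq_iff arc_to_ends_def by blast
    qed simp
    also have "\<dots> \<le> 2" by (cases "u = v") simp_all
    finally show "card (F x) \<le> 2" .
  qed
  finally show ?thesis by simp
qed

text \<open>The smaller half of the degrees carries at most half of the degree sum, which is at most
  2|E|.\<close>

lemma half_le_annihilation_number: "card (verts G) div 2 \<le> annihilation_number G"
proof (rule annihilation_number_ge)
  let ?k = "card (verts G) div 2"
  have "2 * sum_list (take ?k (degree_sequence G)) \<le> sum_list (degree_sequence G)"
    by (rule sum_list_take_sorted_half) (auto simp: sorted_degree_sequence length_degree_sequence)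
  also have "\<dots> \<le> card (arcs G)"
    by (simp add: sum_list_degree_sequence sum_out_degree card_mono)
  also have "\<dots> \<le> 2 * card (edges G)" by (rule card_arcs_le)
  finally show "sum_list (take ?k (degree_sequence G)) \<le> card (edges G)" by simp
qed simp

text \<open>The degree sum counts the arcs with tail in \<open>I\<close>. Their heads lie outside
  \<open>I\<close>, so an edge determines its arc.\<close>

lemma sum_out_degree_independent_set:
  assumes "independent_set G I"
  shows "(\<Sum>v\<in>I. out_degree G v) \<le> card (edges G)"
proof -
  let ?A = "{e \<in> arcs G. tail G e \<in> I}"
  have nadj: "head G e \<notin> I" if "e \<in> ?A" for e
    using that assms by (auto simp: independent_set_def arcs_ends_conv)
  have "inj_on (\<lambda>e. {tail G e, head G e}) ?A"
  proof (rule inj_onI)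
    fix e f assume ef: "e \<in> ?A" "f \<in> ?A" "{tail G e, head G e} = {tail G f, head G f}"
    with nadj[of e] nadj[of f] have "arc_to_ends G e = arc_to_ends G f"
      by (auto simp: arc_to_ends_def doubleton_eq_iff)
    with ef show "e = f" using no_multi_arcs by auto
  qed
  then have "card ?A \<le> card (edges G)"
    by (rule card_inj_on_le) (auto simp: edges_conv)
  then show ?thesis
    using assms by (simp add: sum_out_degree independent_set_def)
qed

text \<open>The degrees over a maximum independent set \<open>I\<close> form a submultiset of the
  degree sequence, so the |I| smallest degrees sum to no more than these, hence to at most
  |E|.\<close>

lemma independence_number_le_annihilation_number:
  "independence_number G \<le> annihilation_number G"
proof -
  obtain I where I: "independent_set G I" "card I = independence_number G"
    by (rule obtain_maximum_independent_set)
  then have sub: "I \<subseteq> verts G" by (simp add: independent_set_def)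
  let ?N = "image_mset (out_degree G) (mset_set I)"
  have "?N \<subseteq># mset (degree_sequence G)"
    unfolding mset_degree_sequence using sub
    by (intro image_mset_subseteq_mono subset_imp_msubset_mset_set) simp_all
  from sum_list_take_sorted_le[OF sorted_degree_sequence this]
  have "sum_list (take (card I) (degree_sequence G)) \<le> (\<Sum>v\<in>I. out_degree G v)"
    by (simp add: sum_unfold_sum_mset)
  also have "\<dots> \<le> card (edges G)"
    by (rule sum_out_degree_independent_set[OF I(1)])
  finally show ?thesis
    using annihilation_number_ge[of "card I"] I(2) card_mono[OF finite_verts sub] by simp
qed

end

section \<open>Claws, connectedness and deficient independent sets\<close>

context graph
begin

lemma dominates_sym: "u \<rightarrow>\<^bsub>G\<^esub> v \<Longrightarrow> v \<rightarrow>\<^bsub>G\<^esub> u"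
  using arcs_ends_symmetric[OF sym_arcs] .

text \<open>Were \<open>a\<close>, \<open>b\<close>, \<open>c\<close> pairwise nonadjacent,
  \<open>{w, a, b, c}\<close> would induce a claw with centre \<open>w\<close>.\<close>

lemma claw_freeD:
  assumes "claw_free G" and "w \<rightarrow>\<^bsub>G\<^esub> a" "w \<rightarrow>\<^bsub>G\<^esub> b" "w \<rightarrow>\<^bsub>G\<^esub> c" and "a \<noteq> b" "a \<noteq> c" "b \<noteq> c"
  shows "a \<rightarrow>\<^bsub>G\<^esub> b \<or> a \<rightarrow>\<^bsub>G\<^esub> c \<or> b \<rightarrow>\<^bsub>G\<^esub> c"
proof (rule ccontr)
  assume nadj: "\<not> ?thesis"
  let ?W = "{w, a, b, c}"
  let ?H = "G \<restriction> ?W"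
  have W: "?W \<subseteq> verts G" using assms by (auto dest: adj_in_verts)
  have adj: "w \<rightarrow>\<^bsub>G\<^esub> x" "x \<rightarrow>\<^bsub>G\<^esub> w" if "x \<in> {a, b, c}" for x
    using that assms(2-4) dominates_sym[OF assms(2)] dominates_sym[OF assms(3)]
      dominates_sym[OF assms(4)] by auto
  have loop: "\<not> x \<rightarrow>\<^bsub>G\<^esub> x" for x using adj_not_same by blast
  have nonadj: "\<not> x \<rightarrow>\<^bsub>G\<^esub> y" if "x \<in> {a, b, c}" "y \<in> {a, b, c}" for x y
    using that nadj loop[of x] by (elim insertE emptyE) (blast dest: dominates_sym)+
  have ind: "induced_subgraph ?H G" using W by (rule induced_induce)
  have "graph ?H"
    using digraphI_induced[OF ind] induced_graph_imp_symmetric[OF sym_arcs ind]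
    by (rule digraph.graphI)
  moreover have "\<exists>U V. verts ?H = U \<union> V \<and> U \<inter> V = {} \<and> card U = 1 \<and> card V = 3
      \<and> arcs_ends ?H = U \<times> V \<union> V \<times> U"
  proof (intro exI conjI)
    show "verts ?H = {w} \<union> {a, b, c}" by auto
    show "{w} \<inter> {a, b, c} = {}" using assms(2-4) loop by auto
    show "card {w} = 1" "card {a, b, c} = 3" using assms(5-7) by auto
    have "arcs_ends ?H = arcs_ends G \<inter> ?W \<times> ?W"
      by (auto simp: arcs_ends_conv)
    then show "arcs_ends ?H = {w} \<times> {a, b, c} \<union> {a, b, c} \<times> {w}"
      using adj nonadj loop[of w] by auto
  qed
  ultimately have "complete_bipartite_digraph 1 3 ?H"
    by (simp only: complete_bipartite_digraph_def simp_thms)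
  with ind assms(1) show False by (auto simp: claw_free_def)
qed

text \<open>Symmetry turns connectedness into strong connectedness, so a set closed under adjacency
  absorbs everything reachable from it.\<close>

lemma connected_closed_eq_verts:
  assumes "Digraph_Component.connected G" and "S \<subseteq> verts G" "S \<noteq> {}"
    and closed: "\<And>u v. u \<in> S \<Longrightarrow> u \<rightarrow>\<^bsub>G\<^esub> v \<Longrightarrow> v \<in> S"
  shows "S = verts G"
proof (rule equalityI[OF assms(2)], rule subsetI)
  fix v assume v: "v \<in> verts G"
  obtain u where u: "u \<in> S" using assms by blast
  have "strongly_connected G"
    using sym_arcs assms(1) by (rule symmetric_connected_imp_strongly_connected)
  then have "u \<rightarrow>\<^sup>*\<^bsub>G\<^esub> v" using u v assms(2) by (auto simp: strongly_connected_def)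
  then show "v \<in> S"
    by (induction rule: reachable_induct) (auto intro: u closed)
qed

text \<open>Connectedness and claw-freeness are exploited only through this lemma. Its two
  conclusions together fix n = 2|J| - 1.\<close>

lemma deficient_independent_set:
  assumes conn: "Digraph_Component.connected G" and claw: "claw_free G"
    and J: "independent_set G J" "card (neighbours G J) < card J"
  shows "card J = Suc (card (neighbours G J))" and "verts G = J \<union> neighbours G J"
proof -
  have "finite {S. S \<subseteq> J \<and> card (neighbours G S) < card S}"
    using finite_independent_set[OF J(1)] by simp
  from finite_has_minimal2[OF this, of J] J(2)
  obtain S where S: "S \<subseteq> J" "card (neighbours G S) < card S"
    and S_min: "\<And>T. T \<subseteq> J \<Longrightarrow> card (neighbours G T) < card T \<Longrightarrow> T \<subseteq> S \<Longrightarrow> S = T"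
    by auto
  have min: "card T \<le> card (neighbours G T)" if "T \<subset> S" for T
    using S_min[of T] S(1) that by (cases "card (neighbours G T) < card T") auto
  have indS: "independent_set G S" using J(1) S(1) by (rule independent_set_subset)
  then have finS: "finite S" by (rule finite_independent_set)
  have "S \<noteq> {}" using S(2) by auto
  \<comment> \<open>Minimality gives |S| - 1 \<le> |N(S - {x})| \<le> |N(S)| < |S|, so the two
    neighbourhoods coincide: every vertex of N(S) has a neighbour in \<open>S\<close> other than
    \<open>x\<close>.\<close>
  have del: "neighbours G (S - {x}) = neighbours G S" "card S = Suc (card (neighbours G S))"
    if x: "x \<in> S" for x
  proof -
    have "card S - 1 \<le> card (neighbours G (S - {x}))"
      using min[of "S - {x}"] x finS by auto
    moreover have sub: "neighbours G (S - {x}) \<subseteq> neighbours G S"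
      by (rule neighbours_mono) auto
    moreover from sub have "card (neighbours G (S - {x})) \<le> card (neighbours G S)"
      by (simp add: card_mono)
    ultimately have "card (neighbours G (S - {x})) = card (neighbours G S)"
      and "card S = Suc (card (neighbours G S))"
      using S(2) by linarith+
    with sub show "neighbours G (S - {x}) = neighbours G S"
      "card S = Suc (card (neighbours G S))"
      by (simp_all add: card_subset_eq)
  qed
  have verts: "S \<union> neighbours G S = verts G"
  proof (rule connected_closed_eq_verts[OF conn])
    show "S \<union> neighbours G S \<subseteq> verts G"
      using indS by (auto simp: independent_set_def neighbours_def)
    show "S \<union> neighbours G S \<noteq> {}" using \<open>S \<noteq> {}\<close> by simp
    fix w c assume w: "w \<in> S \<union> neighbours G S" and wc: "w \<rightarrow>\<^bsub>G\<^esub> c"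
    show "c \<in> S \<union> neighbours G S"
    proof (rule ccontr)
      assume c: "c \<notin> S \<union> neighbours G S"
      \<comment> \<open>As \<open>c\<close> has no neighbour in \<open>S\<close>, the vertex
        \<open>w\<close> lies in N(S), and \<open>c\<close> can be the third leaf beside two
        neighbours of \<open>w\<close> in \<open>S\<close>.\<close>
      then have nadj: "\<not> x \<rightarrow>\<^bsub>G\<^esub> c" if "x \<in> S" for x
        using that adj_in_verts(2)[OF wc] by (auto simp: neighbours_def)
      with w wc obtain a where a: "a \<in> S" "a \<rightarrow>\<^bsub>G\<^esub> w" by (auto simp: neighbours_def)
      moreover have "w \<in> neighbours G (S - {a})"
        using del(1)[OF a(1)] w wc nadj by auto
      then obtain b where b: "b \<in> S" "b \<noteq> a" "b \<rightarrow>\<^bsub>G\<^esub> w" by (auto simp: neighbours_def)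
      ultimately have "a \<rightarrow>\<^bsub>G\<^esub> b \<or> a \<rightarrow>\<^bsub>G\<^esub> c \<or> b \<rightarrow>\<^bsub>G\<^esub> c"
        using c wc dominates_sym[OF a(2)] dominates_sym[OF b(3)]
        by (intro claw_freeD[OF claw, of w]) auto
      then show False
        using nadj a b indS by (auto simp: independent_set_def)
    qed
  qed
  \<comment> \<open>A vertex of \<open>J\<close> outside \<open>S\<close> would lie in N(S), hence
    in N(J), which misses \<open>J\<close>.\<close>
  then have "J = S"
    using S(1) J(1) independent_set_neighbours_disjoint[OF J(1)] neighbours_mono[OF S(1), of G]
    unfolding independent_set_def by blast
  obtain x where "x \<in> S" using \<open>S \<noteq> {}\<close> by blast
  from del(2)[OF this] show "card J = Suc (card (neighbours G J))"
    unfolding \<open>J = S\<close> .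
  from verts show "verts G = J \<union> neighbours G J"
    unfolding \<open>J = S\<close> by (rule sym)
qed

section \<open>Criticality of maximum independent sets, in G or after deleting a vertex\<close>

text \<open>A vertex outside \<open>I\<close> without a neighbour in \<open>I\<close> could be added
  to \<open>I\<close>.\<close>

lemma maximum_independent_set_dominating:
  assumes I: "independent_set G I" "card I = independence_number G"
  shows "neighbours G I = verts G - I"
proof
  show "neighbours G I \<subseteq> verts G - I"
    using I(1) by (auto simp: independent_set_def neighbours_def)
  show "verts G - I \<subseteq> neighbours G I"
  proof (rule subsetI, rule ccontr)
    fix v assume v: "v \<in> verts G - I" "v \<notin> neighbours G I"
    then have "independent_set G (insert v I)"
      using I(1) adj_not_same
      by (auto simp: independent_set_def neighbours_def dest: dominates_sym)
    then have "card (insert v I) \<le> card I"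
      using card_independent_set_le I(2) by metis
    then show False using v finite_independent_set[OF I(1)] by simp
  qed
qed

lemma maximum_independent_set_critical:
  assumes conn: "Digraph_Component.connected G" and claw: "claw_free G"
    and I: "independent_set G I" "card I = independence_number G"
    and half: "card (verts G) \<le> 2 * card I"
  shows "critical_independent_set G I"
  unfolding critical_independent_set_def
proof (intro conjI I allI impI)
  fix J assume J: "independent_set G J"
  have "I \<subseteq> verts G" using I(1) by (simp add: independent_set_def)
  then have cI: "card (neighbours G I) + card I = card (verts G)"
    using maximum_independent_set_dominating[OF I] finite_independent_set[OF I(1)]
    by (simp add: card_Diff_subset card_mono)
  show "int (card J) - int (card (neighbours G J)) \<le> int (card I) - int (card (neighbours G I))"
  proof (cases "card (neighbours G J) < card J")
    case True
    note def = deficient_independent_set[OF conn claw J True]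
    have "card (verts G) = card J + card (neighbours G J)"
      unfolding def(2) using independent_set_neighbours_disjoint[OF J] finite_independent_set[OF J]
      by (simp add: card_Un_disjoint)
    \<comment> \<open>Parity: n = 2|J| - 1 is odd, so n \<le> 2|I| improves to |I| - |N(I)| = 2|I| -
      n \<ge> 1, and 1 is the difference of \<open>J\<close>.\<close>
    with def(1) cI half show ?thesis by presburger
  next
    case False
    with cI half show ?thesis by linarith
  qed
qed

text \<open>
  Sets with as many neighbours as elements are closed under union (submodularity), so the union
  \<open>T\<close> of all of them is again one; any outer vertex not adjacent to \<open>T\<close> can be removed.
\<close>

lemma removable_neighbour:
  assumes I: "finite I" "card I < card (neighbours G I)"
    and hall: "\<And>S. S \<subseteq> I \<Longrightarrow> card S \<le> card (neighbours G S)"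
  obtains v where "v \<in> neighbours G I"
    "\<And>S. S \<subseteq> I \<Longrightarrow> card S \<le> card (neighbours G S - {v})"
proof -
  let ?tight = "\<lambda>S. S \<subseteq> I \<and> card (neighbours G S) = card S"
  have Un: "?tight (S \<union> T)" if "?tight S" "?tight T" for S T
  proof -
    have fin: "finite S" "finite T" using that I(1) finite_subset by auto
    have "card (neighbours G (S \<inter> T)) \<le> card (neighbours G S \<inter> neighbours G T)"
      by (intro card_mono) (auto simp: neighbours_def)
    moreover have "card (S \<inter> T) \<le> card (neighbours G (S \<inter> T))"
      using that by (intro hall) auto
    moreover have "card (S \<union> T) \<le> card (neighbours G (S \<union> T))"
      using that by (intro hall) auto
    ultimately have "card (neighbours G (S \<union> T)) = card (S \<union> T)"
      using that card_Un_Int[OF fin] card_Un_Int[OF finite_neighbours[of S] finite_neighbours[of T]]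
      unfolding neighbours_Un by linarith
    with that show ?thesis by auto
  qed
  have "finite {S. ?tight S}" using I(1) by simp
  moreover have "{} \<in> {S. ?tight S}" by (simp add: neighbours_def)
  ultimately have "\<exists>T \<in> {S. ?tight S}. {} \<subseteq> T \<and> (\<forall>S \<in> {S. ?tight S}. T \<subseteq> S \<longrightarrow> T = S)"
    by (rule finite_has_maximal2)
  then obtain T where T: "?tight T" "\<And>S. ?tight S \<Longrightarrow> T \<subseteq> S \<Longrightarrow> T = S"
    by auto
  have below: "S \<subseteq> T" if "?tight S" for S
    using T(2)[OF Un[OF T(1) that]] by auto
  have "card (neighbours G T) < card (neighbours G I)"
    using T(1) card_mono[OF I(1), of T] I(2) by linarith
  then have "\<not> neighbours G I \<subseteq> neighbours G T"
    using card_mono[OF finite_neighbours, of "neighbours G I" T] by linarith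
  then obtain v where v: "v \<in> neighbours G I" "v \<notin> neighbours G T"
    by (auto simp only: subset_eq)
  have "card S \<le> card (neighbours G S - {v})" if "S \<subseteq> I" for S
  proof (cases "v \<in> neighbours G S")
    case True
    \<comment> \<open>Since \<open>v\<close> is outside N(T), such an \<open>S\<close> is not
      contained in \<open>T\<close>, hence not tight; its surplus pays for the loss of
      \<open>v\<close>.\<close>
    then have "\<not> ?tight S" using below[of S] neighbours_mono[of S T G] v(2) by auto
    then have "card S < card (neighbours G S)" using hall[OF that] that by auto
    then show ?thesis using True by simp
  next
    case False
    then show ?thesis using hall[OF that] by simp
  qed
  with v(1) show ?thesis by (rule that)
qed

text \<open>In G - v the set \<open>I\<close> has difference 0, so it remains to bound |J| by |N(J)
  - {v}| for independent \<open>J\<close> avoiding \<open>v\<close>. Hall's condition applies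
  directly to the part of \<open>J\<close> inside \<open>I\<close>, and through complements to the
  part outside.\<close>

lemma exists_critical_del_vert:
  assumes conn: "Digraph_Component.connected G" and claw: "claw_free G"
    and I: "independent_set G I" "card I = independence_number G"
    and odd: "card (verts G) = Suc (2 * card I)"
  obtains v where "v \<in> verts G" "critical_independent_set (del_vert v) I"
proof -
  have finI: "finite I" by (rule finite_independent_set[OF I(1)])
  have subI: "I \<subseteq> verts G" using I(1) by (simp add: independent_set_def)
  have NI: "neighbours G I = verts G - I" by (rule maximum_independent_set_dominating[OF I])
  then have cNI: "card (neighbours G I) = Suc (card I)"
    using subI odd finI by (simp add: card_Diff_subset)
  \<comment> \<open>A violating \<open>S\<close> would give n \<le> |S| + |N(S)| < 2|S| \<le> 2|I|,
    against \<open>odd\<close>.\<close>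
  have "card S \<le> card (neighbours G S)" if "S \<subseteq> I" for S
  proof (rule ccontr)
    assume less: "\<not> ?thesis"
    have S: "independent_set G S" using I(1) that by (rule independent_set_subset)
    note def = deficient_independent_set[OF conn claw S]
    have "card (verts G) \<le> card S + card (neighbours G S)"
      using def(2) less card_Un_le[of S "neighbours G S"] by simp
    moreover have "card S \<le> card I" using that finI by (simp add: card_mono)
    ultimately show False using odd less by linarith
  qed
  moreover have "card I < card (neighbours G I)" using cNI by simp
  ultimately obtain v where v: "v \<in> neighbours G I"
    and hall: "\<And>S. S \<subseteq> I \<Longrightarrow> card S \<le> card (neighbours G S - {v})"
    using removable_neighbour[OF finI] by blast
  have vI: "v \<in> verts G" "v \<notin> I" using v NI by auto
  have "critical_independent_set (del_vert v) I"
    unfolding critical_independent_set_def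
  proof (intro conjI allI impI)
    show "independent_set (del_vert v) I"
      using I(1) vI by (simp add: independent_set_del_vert)
    fix J assume "independent_set (del_vert v) J"
    then have J: "independent_set G J" "v \<notin> J" by (auto simp: independent_set_del_vert)
    \<comment> \<open>Hall's condition for \<open>?S\<close>, read in the complement, is Hall's condition for \<open>?K\<close>.\<close>
    let ?K = "J - I"
    let ?A = "neighbours G (J \<inter> I) - {v}" and ?B = "neighbours G ?K \<inter> I"
    let ?S = "I - neighbours G ?K"
    have finJ: "finite J" by (rule finite_independent_set[OF J(1)])
    have "card ?S \<le> card (neighbours G ?S - {v})" by (rule hall) auto
    also have "\<dots> \<le> card (neighbours G I - {v} - ?K)"
    proof (rule card_mono)
      \<comment> \<open>By symmetry, a vertex of \<open>I\<close> outside N(\<open>?K\<close>) has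
        no neighbour in \<open>?K\<close>.\<close>
      show "neighbours G ?S - {v} \<subseteq> neighbours G I - {v} - ?K"
        using subI by (auto simp: neighbours_def dest: dominates_sym)
    qed simp
    also have "\<dots> = card (neighbours G I) - 1 - card ?K"
    proof -
      have "?K \<subseteq> neighbours G I - {v}"
        using J unfolding NI by (auto simp: independent_set_def)
      then show ?thesis using finJ v by (simp add: card_Diff_subset)
    qed
    finally have "card ?S + card ?K \<le> card I"
    proof -
      assume le: "card ?S \<le> card (neighbours G I) - 1 - card ?K"
      \<comment> \<open>Subtraction on naturals truncates; since \<open>?K\<close> fits into N(I) -
        {v}, the difference is genuine and \<open>card ?K\<close> can be moved across.\<close>
      have "card ?K \<le> card (neighbours G I - {v})"
        using J unfolding NI by (intro card_mono) (auto simp: independent_set_def)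
      then show ?thesis using le v cNI by simp
    qed
    moreover have "card I = card ?S + card ?B"
      using card_Int_Diff[OF finI, of "neighbours G ?K"] by (simp add: Int_commute)
    ultimately have "card ?K \<le> card ?B" by linarith
    moreover have "card (J \<inter> I) \<le> card ?A" by (rule hall) auto
    moreover have "card J = card (J \<inter> I) + card ?K"
      using finJ by (rule card_Int_Diff)
    \<comment> \<open>\<open>?A\<close> lies outside \<open>I\<close> and \<open>?B\<close> inside,
      so the two counts add up within N(J) - {v}.\<close>
    moreover have "card ?A + card ?B = card (?A \<union> ?B)"
    proof (rule card_Un_disjoint[symmetric])
      have "?A \<subseteq> neighbours G I" by (auto simp: neighbours_def)
      then show "?A \<inter> ?B = {}" unfolding NI by auto
    qed (use finI in auto)
    moreover have "card (?A \<union> ?B) \<le> card (neighbours G J - {v})"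
      using vI by (intro card_mono) (auto simp: neighbours_def)
    ultimately have "card J \<le> card (neighbours (del_vert v) J)"
      using J(2) by (simp add: neighbours_del_vert)
    moreover have "card (neighbours (del_vert v) I) = card I"
      using vI v cNI by (simp add: neighbours_del_vert)
    ultimately show "int (card J) - int (card (neighbours (del_vert v) J))
        \<le> int (card I) - int (card (neighbours (del_vert v) I))"
      by simp
  qed
  with vI(1) show ?thesis by (rule that)
qed

end

section \<open>Characterisation of equality\<close>

theorem theorem7:
  fixes G :: "('a, 'b) pre_digraph"
  assumes "graph G" and "Digraph_Component.connected G" and "claw_free G"
  shows "independence_number G = annihilation_number G \<longleftrightarrow>
    (real (annihilation_number G) \<ge> real (card (verts G)) / 2 \<and>
       critical_independence_number G = annihilation_number G) \<or>
    (real (annihilation_number G) = (real (card (verts G)) - 1) / 2 \<and>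
       (\<exists>v \<in> verts G.
          critical_independence_number (pre_digraph.del_vert G v) = annihilation_number G))"
    (is "?eq \<longleftrightarrow> ?big \<or> ?small")
proof -
  interpret graph G by (rule assms)
  have del: "critical_independence_number (del_vert v) \<le> independence_number G" for v
    using fin_digraph.critical_independence_number_le[OF fin_digraph_del_vert]
      independence_number_del_vert_le by (rule order_trans)
  show ?thesis
  proof
    assume eq: ?eq
    obtain I where I: "independent_set G I" "card I = independence_number G"
      by (rule obtain_maximum_independent_set)
    show "?big \<or> ?small"
    proof (cases "card (verts G) \<le> 2 * card I")
      case True
      then have "critical_independent_set G I"
        by (rule maximum_independent_set_critical[OF assms(2,3) I])
      then have "critical_independence_number G = annihilation_number G"
        using card_critical_independent_set_le critical_independence_number_le I(2) eq
        by (metis order_antisym)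
      then show ?thesis using True I(2) eq by (simp add: field_simps)
    next
      case False
      \<comment> \<open>Here n div 2 \<le> a(G) = |I| while 2|I| < n, which leaves only n = 2|I| +
        1.\<close>
      then have odd: "card (verts G) = Suc (2 * card I)"
        using half_le_annihilation_number I(2) eq by linarith
      obtain v where v: "v \<in> verts G" "critical_independent_set (del_vert v) I"
        by (rule exists_critical_del_vert[OF assms(2,3) I odd])
      from fin_digraph.card_critical_independent_set_le[OF fin_digraph_del_vert v(2)]
      have "critical_independence_number (del_vert v) = annihilation_number G"
        using del[of v] I(2) eq by simp
      then show ?thesis using v(1) odd I(2) eq by auto
    qed
  next
    assume "?big \<or> ?small"
    \<comment> \<open>Either alternative exhibits a(G) as the critical independence number of G or
      of some G - v, and both are at most \<alpha>(G).\<close>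
    then have "annihilation_number G \<le> independence_number G"
      using critical_independence_number_le del by metis
    then show ?eq using independence_number_le_annihilation_number by simp
  qed
qed

end
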